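(* Let $X$ be a real Banach space with closed unit ball $B_X$. Then $X$ is a $K$-space if and only if every $\varepsilon$-Jensen function $f:B_X\to\mathbb{R}$ (for any $\varepsilon$) is uniformly approximable by a Jensen function, i.e. there exists a function $a:B_X\to\mathbb{R}$ satisfying $a\left(\frac{x+y}{2}\right)=\frac{a(x)+a(y)}{2}$ for all $x,y\in B_X$ and $\sup_{x\in B_X}|f(x)-a(x)|<\infty$.
   Context: A map $f:X\to\mathbb{R}$ on a real Banach space $X$ is quasi-linear if it is homogeneous ($f(tx)=tf(x)$ for all $x\in X$, $t\in\mathbb{R}$) and there is a constant $Q$ such that $|f(x+y)-f(x)-f(y)|\le Q(\|x\|+\|y\|)$ for all $x,y\in X$. A Banach space $X$ is a $K$-space if for every quasi-linear map $f:X\to\mathbb{R}$ there is a linear (not necessarily continuous) functional $\ell:X\to\mathbb{R}$ and a constant $M$ such that $|f(x)-\ell(x)|\le M\|x\|$ for all $x\in X$. For a convex set $D$, a function $f:D\to\mathbb{R}$ is $\varepsilon$-Jensen if $\left|f\left(\frac{x+y}{2}\right)-\frac{f(x)+f(y)}{2}\right|\le\varepsilon$ for all $x,y\in D$. *)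

theory Defs
  imports "HOL-Analysis.Analysis"
begin

definition quasi_linear :: "('a::real_normed_vector \<Rightarrow> real) \<Rightarrow> bool" where
  "quasi_linear f \<longleftrightarrow>
     (\<forall>t x. f (t *\<^sub>R x) = t * f x) \<and>
     (\<exists>Q. \<forall>x y. \<bar>f (x + y) - f x - f y\<bar> \<le> Q * (norm x + norm y))"

text \<open>A Banach space is a type of class \<open>banach\<close>, so being a K-space is a property of
  a type. The functional \<open>l\<close> below is only linear, not necessarily bounded.\<close>

definition K_space :: "'a::banach itself \<Rightarrow> bool" where
  "K_space (_ :: 'a itself) \<longleftrightarrow>
     (\<forall>f :: 'a \<Rightarrow> real. quasi_linear f \<longrightarrow>
        (\<exists>l :: 'a \<Rightarrow> real. linear l \<and> (\<exists>M. \<forall>x. \<bar>f x - l x\<bar> \<le> M * norm x)))"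

text \<open>A function on a convex set \<open>D\<close> is a total function of which only the values on \<open>D\<close>
  matter; convexity of \<open>D\<close> is not part of the definitions, but guarantees that the midpoints
  lie in \<open>D\<close>.\<close>

definition eps_Jensen_on :: "real \<Rightarrow> 'a::real_vector set \<Rightarrow> ('a \<Rightarrow> real) \<Rightarrow> bool" where
  "eps_Jensen_on \<epsilon> D f \<longleftrightarrow>
     (\<forall>x\<in>D. \<forall>y\<in>D. \<bar>f ((x + y) /\<^sub>R 2) - (f x + f y) / 2\<bar> \<le> \<epsilon>)"

definition Jensen_on :: "'a::real_vector set \<Rightarrow> ('a \<Rightarrow> real) \<Rightarrow> bool" where
  "Jensen_on D a \<longleftrightarrow> (\<forall>x\<in>D. \<forall>y\<in>D. a ((x + y) /\<^sub>R 2) = (a x + a y) / 2)"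

end

theory Submission
  imports Defs
begin

text \<open>Transporting an approximately Jensen function on the ball from the shell
  \<open>1/2 < norm x \<le> 1\<close> to the whole space by dyadic dilations yields a quasi-additive map \<open>F\<close> with
  \<open>F (2 x) = 2 F x\<close>. On a line, \<open>F\<close> may be close only to a discontinuous additive function, so \<open>F\<close> itself
  need not be near a homogeneous map. Choosing such an additive function on every line spanned by
  a Hamel basis vector and adding them up gives an additive \<open>L\<close> such that \<open>F - L\<close> is regular on
  every line. Since \<open>F - L\<close> is uniformly almost \<open>\<rat>\<close>-homogeneous, it is then almost \<open>\<real>\<close>-homogeneous
  and hence close to a quasi-linear map, to which the K-space property applies. For the converse,
  the Jensen approximant of a quasi-linear map extends to an additive map, and closeness to a
  homogeneous map forces it to be linear.\<close>

section \<open>Dyadic scaling\<close>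

text \<open>Exact homogeneity is asked for the factor 2 only: this is what a construction by dyadic
  dilations provides, and it survives subtracting an arbitrary additive map.\<close>

definition dyadic_quasi_additive :: "real \<Rightarrow> ('a::real_normed_vector \<Rightarrow> real) \<Rightarrow> bool" where
  "dyadic_quasi_additive Q g \<longleftrightarrow>
     (\<forall>x. g (2 *\<^sub>R x) = 2 * g x) \<and>
     (\<forall>x y. \<bar>g (x + y) - g x - g y\<bar> \<le> Q * (norm x + norm y))"

lemma dyadic_scale_nat:
  fixes g :: "'a::real_vector \<Rightarrow> real"
  assumes "\<And>x. g (2 *\<^sub>R x) = 2 * g x"
  shows "g ((2 ^ n) *\<^sub>R x) = 2 ^ n * g x"
proof (induction n)
  case (Suc n)
  have "g ((2 ^ Suc n) *\<^sub>R x) = g (2 *\<^sub>R ((2 ^ n) *\<^sub>R x))" by simp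
  also have "\<dots> = 2 * g ((2 ^ n) *\<^sub>R x)" by (rule assms)
  finally show ?case using Suc.IH by simp
qed simp

lemma dyadic_scale_int:
  fixes g :: "'a::real_vector \<Rightarrow> real"
  assumes "\<And>x. g (2 *\<^sub>R x) = 2 * g x"
  shows "g ((2 powi k) *\<^sub>R x) = 2 powi k * g x"
proof (cases k rule: int_cases2)
  case (nonneg n)
  then show ?thesis using dyadic_scale_nat[where g = g, OF assms] by simp
next
  case (nonpos n)
  have "g x = g ((2 ^ n) *\<^sub>R ((2 powi k) *\<^sub>R x))"
    by (simp add: nonpos power_int_minus)
  also have "\<dots> = 2 ^ n * g ((2 powi k) *\<^sub>R x)" by (rule dyadic_scale_nat[where g = g, OF assms])
  finally show ?thesis by (simp add: nonpos power_int_minus)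
qed

text \<open>Dividing a vector of norm \<open>r\<close> by this power of two moves it into the shell
  where the norm lies in (1/2, 1].\<close>

lemma dyadic_bracket:
  assumes "r > 0"
  shows "r \<le> 2 powi \<lceil>log 2 r\<rceil>" and "2 powi \<lceil>log 2 r\<rceil> < 2 * r"
proof -
  have r: "2 powr log 2 r = r" using assms by simp
  have "2 powr log 2 r \<le> 2 powr (real_of_int \<lceil>log 2 r\<rceil>)"
    by (intro powr_mono) auto
  then show "r \<le> 2 powi \<lceil>log 2 r\<rceil>" using r by (simp add: powr_real_of_int')
  have "2 powr (real_of_int \<lceil>log 2 r\<rceil>) < 2 powr (log 2 r + 1)"
    by (intro powr_less_mono) linarith+
  also have "\<dots> = 2 * r" using r by (simp add: powr_add)
  finally show "2 powi \<lceil>log 2 r\<rceil> < 2 * r" by (simp add: powr_real_of_int')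
qed

text \<open>A dyadic dilation brings \<open>x\<close> into the unit ball, where \<open>C\<close>
  applies; the factor 2 is the price of rounding \<open>norm x\<close> up to a power of two.\<close>

lemma dyadic_bound:
  fixes g :: "'a::real_normed_vector \<Rightarrow> real"
  assumes dbl: "\<And>x. g (2 *\<^sub>R x) = 2 * g x"
    and C: "\<And>x. norm x \<le> 1 \<Longrightarrow> \<bar>g x\<bar> \<le> C"
  shows "\<bar>g x\<bar> \<le> 2 * C * norm x"
proof (cases "x = 0")
  case True
  have "g 0 = 0" using dbl[of 0] by simp
  with True show ?thesis by simp
next
  case False
  define p :: real where "p = 2 powi \<lceil>log 2 (norm x)\<rceil>"
  have p: "norm x \<le> p" "p < 2 * norm x" "p > 0"
    using dyadic_bracket[of "norm x"] False by (auto simp: p_def)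
  have "x = p *\<^sub>R (x /\<^sub>R p)" using p by simp
  then have "g x = p * g (x /\<^sub>R p)" unfolding p_def using dyadic_scale_int[where g = g, OF dbl] by metis
  moreover have "\<bar>g (x /\<^sub>R p)\<bar> \<le> C" using p by (intro C) (simp add: field_simps)
  ultimately have "\<bar>g x\<bar> \<le> p * C" using p by (simp add: abs_mult)
  moreover have "0 \<le> C" using C[of 0] by simp
  then have "p * C \<le> (2 * norm x) * C" using p by (intro mult_right_mono) auto
  ultimately show ?thesis by (simp add: mult.commute mult.left_commute)
qed

section \<open>From the unit ball to the whole space\<close>

text \<open>The Jensen inequality for a point and the origin controls one halving. The step from
  \<open>n\<close> to \<open>Suc n\<close> costs \<open>\<epsilon> / 2 ^ n\<close>, and these costs
  form a geometric series.\<close>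

lemma eps_Jensen_halving:
  fixes f :: "'a::real_normed_vector \<Rightarrow> real"
  assumes J: "eps_Jensen_on \<epsilon> (cball 0 1) f" and f0: "f 0 = 0"
    and x: "norm ((2 ^ n) *\<^sub>R x) \<le> 1"
  shows "\<bar>f x - f ((2 ^ n) *\<^sub>R x) / 2 ^ n\<bar> \<le> 2 * \<epsilon> * (1 - 1 / 2 ^ n)"
  using x
proof (induction n)
  case (Suc n)
  let ?y = "(2 ^ Suc n) *\<^sub>R x" and ?z = "(2 ^ n) *\<^sub>R x"
  have "norm ?z \<le> norm ?y" by (simp add: mult_right_mono)
  with Suc have IH: "\<bar>f x - f ?z / 2 ^ n\<bar> \<le> 2 * \<epsilon> * (1 - 1 / 2 ^ n)" by force
  have "\<bar>f ((?y + 0) /\<^sub>R 2) - (f ?y + f 0) / 2\<bar> \<le> \<epsilon>"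
    using J Suc.prems unfolding eps_Jensen_on_def by (metis dist_0_norm mem_cball norm_zero zero_le_one)
  then have "\<bar>f ?z - f ?y / 2\<bar> \<le> \<epsilon>" using f0 by simp
  then have "\<bar>f ?z - f ?y / 2\<bar> / 2 ^ n \<le> \<epsilon> / 2 ^ n" by (intro divide_right_mono) auto
  moreover have "f ?z / 2 ^ n - f ?y / 2 ^ Suc n = (f ?z - f ?y / 2) / 2 ^ n"
    by (simp add: diff_divide_distrib)
  then have "\<bar>f ?z / 2 ^ n - f ?y / 2 ^ Suc n\<bar> = \<bar>f ?z - f ?y / 2\<bar> / 2 ^ n"
    by (simp only: abs_divide) simp
  ultimately have "\<bar>f x - f ?y / 2 ^ Suc n\<bar> \<le> 2 * \<epsilon> * (1 - 1 / 2 ^ n) + \<epsilon> / 2 ^ n"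
    using IH by linarith
  also have "\<dots> = 2 * \<epsilon> * (1 - 1 / 2 ^ Suc n)" by (simp add: field_simps)
  finally show ?case .
qed simp

lemma eps_Jensen_dyadic_extension:
  fixes f :: "'a::real_normed_vector \<Rightarrow> real"
  assumes J: "eps_Jensen_on \<epsilon> (cball 0 1) f" and f0: "f 0 = 0"
  obtains F where "dyadic_quasi_additive (20 * \<epsilon>) F"
    and "\<And>x. norm x \<le> 1 \<Longrightarrow> \<bar>F x - f x\<bar> \<le> 2 * \<epsilon>"
proof -
  have J': "\<bar>f ((x + y) /\<^sub>R 2) - (f x + f y) / 2\<bar> \<le> \<epsilon>" if "norm x \<le> 1" "norm y \<le> 1" for x y
    using J that by (auto simp: eps_Jensen_on_def)
  have e0: "0 \<le> \<epsilon>" using J'[of 0 0] by simp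
  define p :: "'a \<Rightarrow> real" where "p x = 2 powi \<lceil>log 2 (norm x)\<rceil>" for x
  \<comment> \<open>\<open>F\<close> agrees with \<open>f\<close> on the shell \<open>1/2 < norm x \<le> 1\<close>.\<close>
  define F where "F x = p x * f (x /\<^sub>R p x)" for x
  have F0: "F 0 = 0" by (simp add: F_def f0)
  have dbl: "F (2 *\<^sub>R x) = 2 * F x" for x
  proof (cases "x = 0")
    case False
    have "log 2 (norm (2 *\<^sub>R x)) = 1 + log 2 (norm x)" using False by (simp add: log_mult)
    then have "\<lceil>log 2 (norm (2 *\<^sub>R x))\<rceil> = \<lceil>log 2 (norm x)\<rceil> + 1"
      by (metis add.commute ceiling_add_one)
    then have "p (2 *\<^sub>R x) = 2 * p x" by (simp add: p_def power_int_add)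
    then show ?thesis by (simp add: F_def)
  qed (simp add: F0)
  have near: "\<bar>F x - f x\<bar> \<le> 2 * \<epsilon>" if x: "norm x \<le> 1" for x
  proof (cases "x = 0")
    case False
    have "log 2 (norm x) \<le> 0" using False x by simp
    then have "\<lceil>log 2 (norm x)\<rceil> \<le> 0" by simp
    then obtain n where "\<lceil>log 2 (norm x)\<rceil> = - int n" by (metis nonpos_int_cases)
    then have p: "p x = inverse (2 ^ n)" by (simp add: p_def power_int_minus)
    have "norm x \<le> p x" using dyadic_bracket[of "norm x"] False by (simp add: p_def)
    then have "norm ((2 ^ n) *\<^sub>R x) \<le> 1" by (simp add: p field_simps)
    from eps_Jensen_halving[OF J f0 this]
    have "\<bar>f x - F x\<bar> \<le> 2 * \<epsilon> * (1 - 1 / 2 ^ n)" by (simp add: F_def p field_simps)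
    also have "\<dots> \<le> 2 * \<epsilon> * 1" using e0 by (intro mult_left_mono) auto
    finally show ?thesis by (simp add: abs_minus_commute)
  qed (simp add: F0 f0 e0)
  \<comment> \<open>The midpoint stays in the ball. Doubling its estimates gives 4 from
    \<open>near\<close> and 2 from the Jensen defect; \<open>near\<close> at \<open>x\<close> and at
    \<open>y\<close> adds 2 each, hence 10.\<close>
  have ball: "\<bar>F (x + y) - F x - F y\<bar> \<le> 10 * \<epsilon>" if xy: "norm x \<le> 1" "norm y \<le> 1" for x y
  proof -
    have "norm ((x + y) /\<^sub>R 2) \<le> 1" using norm_triangle_ineq[of x y] xy by simp
    then have "\<bar>F ((x + y) /\<^sub>R 2) - f ((x + y) /\<^sub>R 2)\<bar> \<le> 2 * \<epsilon>" by (rule near)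
    moreover have "F (x + y) = 2 * F ((x + y) /\<^sub>R 2)" using dbl[of "(x + y) /\<^sub>R 2"] by simp
    ultimately show ?thesis using near[OF xy(1)] near[OF xy(2)] J'[OF xy]
      by (simp only: abs_le_iff) argo
  qed
  have "\<bar>F (x + y) - F x - F y\<bar> \<le> 20 * \<epsilon> * (norm x + norm y)" for x y
  proof (cases "x = 0 \<and> y = 0")
    case False
    \<comment> \<open>A common dilation, fitted to the larger norm, puts both vectors into the ball.
      Since \<open>q < 2 * r\<close>, undoing it turns 10 into 20.\<close>
    define r where "r = max (norm x) (norm y)"
    have r: "r > 0" "norm x \<le> r" "norm y \<le> r" "r \<le> norm x + norm y"
      using False by (auto simp: r_def less_max_iff_disj)
    define q :: real where "q = 2 powi \<lceil>log 2 r\<rceil>"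
    have q: "r \<le> q" "q < 2 * r" using dyadic_bracket[of r] r by (auto simp: q_def)
    have sc: "F z = q * F (z /\<^sub>R q)" for z
    proof -
      have "z = q *\<^sub>R (z /\<^sub>R q)" using q r by simp
      then show ?thesis unfolding q_def using dyadic_scale_int[where g = F, OF dbl] by metis
    qed
    have "\<bar>F (x /\<^sub>R q + y /\<^sub>R q) - F (x /\<^sub>R q) - F (y /\<^sub>R q)\<bar> \<le> 10 * \<epsilon>"
      using q r by (intro ball) (simp_all add: field_simps)
    then have "q * \<bar>F (x /\<^sub>R q + y /\<^sub>R q) - F (x /\<^sub>R q) - F (y /\<^sub>R q)\<bar> \<le> q * (10 * \<epsilon>)"
      using q r by (intro mult_left_mono) auto
    moreover have "F (x + y) - F x - F y
        = q * (F (x /\<^sub>R q + y /\<^sub>R q) - F (x /\<^sub>R q) - F (y /\<^sub>R q))"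
      by (simp add: sc[of "x + y"] sc[of x] sc[of y] scaleR_add_right right_diff_distrib)
    ultimately have "\<bar>F (x + y) - F x - F y\<bar> \<le> q * (10 * \<epsilon>)"
      using q r by (simp add: abs_mult)
    also have "\<dots> \<le> (2 * (norm x + norm y)) * (10 * \<epsilon>)"
      using q r e0 by (intro mult_right_mono) auto
    finally show ?thesis by (simp add: algebra_simps)
  qed (auto simp: F0)
  with dbl near show ?thesis by (intro that[of F]) (auto simp: dyadic_quasi_additive_def)
qed

section \<open>Almost homogeneity of quasi-additive maps\<close>

context
  fixes Q :: real and g :: "'a::real_normed_vector \<Rightarrow> real"
  assumes Q: "0 \<le> Q" and g: "dyadic_quasi_additive Q g"
begin

lemma quasi_additive_double: "g (2 *\<^sub>R x) = 2 * g x"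
  and quasi_additive_add: "\<bar>g (x + y) - g x - g y\<bar> \<le> Q * (norm x + norm y)"
  using g by (auto simp: dyadic_quasi_additive_def)

lemma quasi_additive_zero: "g 0 = 0"
  using quasi_additive_double[of 0] by simp

lemma quasi_additive_nat: "\<bar>g (real m *\<^sub>R x) - real m * g x\<bar> \<le> 2 * Q * real m * norm x"
proof (induction m rule: less_induct)
  case (less m)
  show ?case
  proof (cases "m = 0")
    case False
    \<comment> \<open>Splitting off the leading binary digit leaves a remainder of at most half the size,
      so the errors sum up geometrically.\<close>
    then obtain j where j: "2 ^ j \<le> m" "m < 2 ^ (j + 1)" using ex_power_ivl1[of 2 m] by auto
    define r where "r = m - 2 ^ j"
    have m: "real m = 2 ^ j + real r" using j by (simp add: r_def of_nat_diff)
    have "2 * r \<le> m" "r < m" using j False by (auto simp: r_def)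
    then have r2: "2 * real r \<le> real m" by linarith
    have "\<bar>g ((2 ^ j) *\<^sub>R x + real r *\<^sub>R x) - g ((2 ^ j) *\<^sub>R x) - g (real r *\<^sub>R x)\<bar>
        \<le> Q * (norm ((2 ^ j) *\<^sub>R x) + norm (real r *\<^sub>R x))"
      by (rule quasi_additive_add)
    then have "\<bar>g (real m *\<^sub>R x) - 2 ^ j * g x - g (real r *\<^sub>R x)\<bar> \<le> Q * (real m * norm x)"
      by (simp add: m scaleR_add_left dyadic_scale_nat[where g = g, OF quasi_additive_double] algebra_simps)
    moreover have "\<bar>g (real r *\<^sub>R x) - real r * g x\<bar> \<le> 2 * Q * real r * norm x"
      by (rule less.IH[OF \<open>r < m\<close>])
    moreover have "2 * Q * real r * norm x \<le> Q * (real m * norm x)"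
      using mult_left_mono[OF r2, of "Q * norm x"] Q by (simp add: algebra_simps)
    moreover have "real m * g x = 2 ^ j * g x + real r * g x" by (simp add: m algebra_simps)
    ultimately show ?thesis by linarith
  qed (simp add: quasi_additive_zero)
qed

text \<open>Both \<open>x\<close> and \<open>q *\<^sub>R x\<close> are natural multiples of
  \<open>x /\<^sub>R real n\<close>, and each comparison costs \<open>2 * Q * q * norm x\<close>.
  The denominator cancels, so the bound can be used for rationals approaching a real number.\<close>

lemma quasi_additive_rat_nonneg:
  assumes q: "q \<in> \<rat>" "0 \<le> q"
  shows "\<bar>g (q *\<^sub>R x) - q * g x\<bar> \<le> 4 * Q * q * norm x"
proof -
  obtain m n where n: "n \<noteq> 0" and qmn: "\<bar>q\<bar> = real m / real n"
    using Rats_abs_nat_div_natE[OF q(1)] by metis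
  then have qmn: "q = real m / real n" using q by simp
  define y where "y = x /\<^sub>R real n"
  have x: "x = real n *\<^sub>R y" using n by (simp add: y_def)
  have qx: "q *\<^sub>R x = real m *\<^sub>R y" by (simp add: y_def qmn divide_inverse)
  have 1: "\<bar>g (real m *\<^sub>R y) - real m * g y\<bar> \<le> 2 * Q * real m * norm y"
    by (rule quasi_additive_nat)
  have "q * \<bar>g x - real n * g y\<bar> \<le> q * (2 * Q * real n * norm y)"
    using quasi_additive_nat[of n y] q unfolding x[symmetric] by (intro mult_left_mono) auto
  moreover have "q * g x - real m * g y = q * (g x - real n * g y)"
    using n by (simp add: qmn right_diff_distrib)
  ultimately have "\<bar>q * g x - real m * g y\<bar> \<le> q * (2 * Q * real n * norm y)"
    using q by (simp only: abs_mult abs_of_nonneg)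
  moreover have "q * (2 * Q * real n * norm y) = 2 * Q * q * norm x"
    "2 * Q * real m * norm y = 2 * Q * q * norm x"
    using n by (simp_all add: x qmn)
  ultimately show ?thesis using 1 unfolding qx by (simp only: abs_le_iff) argo
qed

text \<open>For negative \<open>q\<close>, the values at \<open>q *\<^sub>R x\<close> and at its
  negative add up to zero within \<open>2 * Q * \<bar>q\<bar> * norm x\<close>, which raises 4 to
  6.\<close>

lemma quasi_additive_rat:
  assumes q: "q \<in> \<rat>"
  shows "\<bar>g (q *\<^sub>R x) - q * g x\<bar> \<le> 6 * Q * \<bar>q\<bar> * norm x"
proof (cases "0 \<le> q")
  case True
  have "0 \<le> Q * q * norm x" using True Q by simp
  with quasi_additive_rat_nonneg[OF q True, of x] True show ?thesis by simp
next
  case False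
  then have "\<bar>g ((- q) *\<^sub>R x) - (- q) * g x\<bar> \<le> 4 * Q * (- q) * norm x"
    using q by (intro quasi_additive_rat_nonneg) auto
  moreover have "\<bar>g (q *\<^sub>R x + (- q) *\<^sub>R x) - g (q *\<^sub>R x) - g ((- q) *\<^sub>R x)\<bar>
      \<le> Q * (norm (q *\<^sub>R x) + norm ((- q) *\<^sub>R x))" by (rule quasi_additive_add)
  moreover have "q *\<^sub>R x + (- q) *\<^sub>R x = 0" by simp
  ultimately show ?thesis using False
    by (simp add: quasi_additive_zero abs_le_iff algebra_simps)
qed

text \<open>Growth at most linear along the line makes \<open>g ((t - q) *\<^sub>R x)\<close>
  negligible for rational \<open>q\<close> near \<open>t\<close>. The constant \<open>C\<close>
  vanishes in the limit, so the result is uniform in \<open>x\<close> even if \<open>C\<close> is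
  not; splitting \<open>t\<close> into \<open>q\<close> and \<open>t - q\<close> raises 6 to
  7.\<close>

lemma quasi_additive_real:
  assumes C: "\<And>s. \<bar>g (s *\<^sub>R x)\<bar> \<le> C * \<bar>s\<bar>"
  shows "\<bar>g (t *\<^sub>R x) - t * g x\<bar> \<le> 7 * Q * \<bar>t\<bar> * norm x"
proof (rule field_le_epsilon)
  fix e :: real assume e: "0 < e"
  \<comment> \<open>\<open>K\<close> collects the coefficients of \<open>\<bar>t - q\<bar>\<close>:
    7 from replacing \<open>\<bar>q\<bar>\<close> by \<open>\<bar>t\<bar>\<close>, 1 from the
    splitting, then those of steps 3 and 4. The summand 1 makes it positive.\<close>
  define K where "K = 8 * Q * norm x + \<bar>g x\<bar> + \<bar>C\<bar> + 1"
  have K: "K > 0" using Q by (simp add: K_def add_nonneg_pos)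
  obtain q where q: "q \<in> \<rat>" and "t < q" "q < t + e / K"
    using Rats_dense_in_real[of t "t + e / K"] e K by auto
  then have d: "\<bar>t - q\<bar> \<le> e / K" by simp
  have "\<bar>g (q *\<^sub>R x + (t - q) *\<^sub>R x) - g (q *\<^sub>R x) - g ((t - q) *\<^sub>R x)\<bar>
      \<le> Q * (norm (q *\<^sub>R x) + norm ((t - q) *\<^sub>R x))" by (rule quasi_additive_add)
  then have 1: "\<bar>g (t *\<^sub>R x) - g (q *\<^sub>R x) - g ((t - q) *\<^sub>R x)\<bar>
      \<le> Q * \<bar>q\<bar> * norm x + Q * \<bar>t - q\<bar> * norm x"
    by (simp add: scaleR_add_left[symmetric] distrib_left mult.assoc)
  have 2: "\<bar>g (q *\<^sub>R x) - q * g x\<bar> \<le> 6 * Q * \<bar>q\<bar> * norm x" by (rule quasi_additive_rat[OF q])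
  have 3: "\<bar>g ((t - q) *\<^sub>R x)\<bar> \<le> \<bar>C\<bar> * \<bar>t - q\<bar>"
    by (rule order_trans[OF C]) (simp add: mult_right_mono)
  have 4: "\<bar>q * g x - t * g x\<bar> \<le> \<bar>g x\<bar> * \<bar>t - q\<bar>"
    by (metis abs_minus_commute abs_mult left_diff_distrib mult.commute order_refl)
  have "\<bar>q\<bar> \<le> \<bar>t\<bar> + \<bar>t - q\<bar>" by simp
  then have "7 * Q * norm x * \<bar>q\<bar> \<le> 7 * Q * norm x * (\<bar>t\<bar> + \<bar>t - q\<bar>)"
    using Q by (intro mult_left_mono) auto
  then have 5: "7 * (Q * \<bar>q\<bar> * norm x) \<le> 7 * Q * \<bar>t\<bar> * norm x + 7 * Q * norm x * \<bar>t - q\<bar>"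
    by (simp add: algebra_simps)
  have "\<bar>g (t *\<^sub>R x) - t * g x\<bar>
      \<le> 7 * (Q * \<bar>q\<bar> * norm x) + (Q * \<bar>t - q\<bar> * norm x + \<bar>C\<bar> * \<bar>t - q\<bar> + \<bar>g x\<bar> * \<bar>t - q\<bar>)"
    using 1 2 3 4 by (simp only: abs_le_iff) argo
  also have "\<dots> \<le> 7 * Q * \<bar>t\<bar> * norm x + K * \<bar>t - q\<bar>"
    using 5 by (simp add: K_def algebra_simps)
  also have "K * \<bar>t - q\<bar> \<le> e" using d K by (simp add: field_simps)
  finally show "\<bar>g (t *\<^sub>R x) - t * g x\<bar> \<le> 7 * Q * \<bar>t\<bar> * norm x + e" by simp
qed

end

section \<open>Additive approximation along a line\<close>

lemma additive_approximation_real: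
  fixes G :: "real \<Rightarrow> real"
  assumes K: "0 \<le> K"
    and add: "\<And>s t. \<bar>G (s + t) - G s - G t\<bar> \<le> K * (\<bar>s\<bar> + \<bar>t\<bar>)"
    and rat: "\<And>q. q \<in> \<rat> \<Longrightarrow> \<bar>G q\<bar> \<le> K * \<bar>q\<bar>"
  obtains a where "\<And>s t. a (s + t) = a s + a t" and "\<And>t. \<bar>G t - a t\<bar> \<le> 3 * K * \<bar>t\<bar>"
proof -
  \<comment> \<open>\<open>a t\<close> stands for the limit of \<open>G (t - q)\<close> as \<open>q\<close> tends to \<open>t\<close> through the rationals;
    taking the supremum of the lower bounds avoids the limit.\<close>
  define a where "a t = (SUP q\<in>\<rat>. G (t - q) - 3 * K * \<bar>t - q\<bar>)" for t
  \<comment> \<open>The two arguments differ by a rational, where \<open>G\<close> is small. The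
    cost \<open>K * \<bar>t - q'\<bar> + 2 * K * \<bar>q' - q\<bar>\<close> fits under the factor 3
    by the triangle inequality.\<close>
  have cross: "G (t - q) - 3 * K * \<bar>t - q\<bar> \<le> G (t - q') + 3 * K * \<bar>t - q'\<bar>"
    if "q \<in> \<rat>" "q' \<in> \<rat>" for t q q'
  proof -
    have "\<bar>G ((t - q') + (q' - q)) - G (t - q') - G (q' - q)\<bar> \<le> K * (\<bar>t - q'\<bar> + \<bar>q' - q\<bar>)"
      by (rule add)
    moreover have "\<bar>G (q' - q)\<bar> \<le> K * \<bar>q' - q\<bar>" using that by (intro rat) auto
    moreover have "K * \<bar>q' - q\<bar> \<le> K * (\<bar>t - q\<bar> + \<bar>t - q'\<bar>)"
      using K by (intro mult_left_mono) auto
    moreover have "0 \<le> K * \<bar>t - q\<bar>" "0 \<le> K * \<bar>t - q'\<bar>" using K by auto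
    ultimately show ?thesis by (simp add: algebra_simps abs_le_iff)
  qed
  have up: "a t \<le> G (t - q) + 3 * K * \<bar>t - q\<bar>" if "q \<in> \<rat>" for t q
    unfolding a_def using cross that by (intro cSUP_least) (auto intro: Rats_0)
  have lo: "G (t - q) - 3 * K * \<bar>t - q\<bar> \<le> a t" if "q \<in> \<rat>" for t q
    unfolding a_def
  proof (rule cSUP_upper[OF that])
    show "bdd_above ((\<lambda>q. G (t - q) - 3 * K * \<bar>t - q\<bar>) ` \<rat>)"
      using cross[OF _ Rats_0, of _ t] by (intro bdd_aboveI2) auto
  qed
  have near: "\<bar>G (t - q) - a t\<bar> \<le> 3 * K * \<bar>t - q\<bar>" if "q \<in> \<rat>" for t q
    using up[OF that, of t] lo[OF that, of t] by (simp add: abs_le_iff)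
  have "\<bar>a (s + t) - (a s + a t)\<bar> \<le> 0" for s t
  proof (rule field_le_epsilon)
    fix e :: real assume e: "0 < e"
    \<comment> \<open>The error is 2 from quasi-additivity, 6 from \<open>near\<close> at
      \<open>s + t\<close>, and 3 each from \<open>near\<close> at \<open>s\<close> and
      \<open>t\<close>, in units of \<open>K * d\<close>: 14 in all.\<close>
    define d where "d = e / (14 * K + 1)"
    have d: "0 < d" "14 * (K * d) \<le> e" using e K by (auto simp: d_def field_simps)
    obtain q where q: "q \<in> \<rat>" "s < q" "q < s + d" using Rats_dense_in_real[of s "s + d"] d by auto
    obtain p where p: "p \<in> \<rat>" "t < p" "p < t + d" using Rats_dense_in_real[of t "t + d"] d by auto
    have bd: "K * \<bar>s - q\<bar> \<le> K * d" "K * \<bar>t - p\<bar> \<le> K * d" "K * \<bar>(s + t) - (q + p)\<bar> \<le> K * (2 * d)"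
      using q p K by (intro mult_left_mono; simp)+
    have "\<bar>G ((s - q) + (t - p)) - G (s - q) - G (t - p)\<bar> \<le> K * (\<bar>s - q\<bar> + \<bar>t - p\<bar>)"
      by (rule add)
    then have "\<bar>G ((s + t) - (q + p)) - G (s - q) - G (t - p)\<bar> \<le> K * \<bar>s - q\<bar> + K * \<bar>t - p\<bar>"
      by (simp add: algebra_simps)
    moreover have "\<bar>G ((s + t) - (q + p)) - a (s + t)\<bar> \<le> 3 * K * \<bar>(s + t) - (q + p)\<bar>"
      using q p by (intro near) auto
    ultimately show "\<bar>a (s + t) - (a s + a t)\<bar> \<le> 0 + e"
      using near[OF q(1), of s] near[OF p(1), of t] bd d
      by (simp only: abs_le_iff mult.assoc) argo
  qed
  then have "a (s + t) = a s + a t" for s t by simp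
  moreover have "\<bar>G t - a t\<bar> \<le> 3 * K * \<bar>t\<bar>" for t using near[of 0 t] by simp
  ultimately show ?thesis by (rule that)
qed

text \<open>The constant involves \<open>F x\<close> and is not uniform over lines; this suffices,
  because \<open>quasi_additive_real\<close> does not pass it on to its conclusion.\<close>

lemma additive_approximation_line:
  fixes F :: "'a::real_normed_vector \<Rightarrow> real"
  assumes Q: "0 \<le> Q" and F: "dyadic_quasi_additive Q F"
  shows "\<exists>a. (\<forall>s t. a (s + t) = a s + a t) \<and> (\<exists>C. \<forall>t. \<bar>F (t *\<^sub>R x) - a t\<bar> \<le> C * \<bar>t\<bar>)"
proof -
  define K where "K = 6 * Q * norm x + \<bar>F x\<bar>"
  have K: "0 \<le> K" "Q * norm x \<le> K" using Q by (auto simp: K_def intro: add_increasing2)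
  have "\<bar>F ((s + t) *\<^sub>R x) - F (s *\<^sub>R x) - F (t *\<^sub>R x)\<bar> \<le> K * (\<bar>s\<bar> + \<bar>t\<bar>)" for s t
  proof -
    have "\<bar>F ((s + t) *\<^sub>R x) - F (s *\<^sub>R x) - F (t *\<^sub>R x)\<bar> \<le> (Q * norm x) * (\<bar>s\<bar> + \<bar>t\<bar>)"
      using quasi_additive_add[OF Q F, of "s *\<^sub>R x" "t *\<^sub>R x"]
      by (simp add: scaleR_add_left algebra_simps)
    also have "\<dots> \<le> K * (\<bar>s\<bar> + \<bar>t\<bar>)" using K by (intro mult_right_mono) auto
    finally show ?thesis .
  qed
  moreover have "\<bar>F (q *\<^sub>R x)\<bar> \<le> K * \<bar>q\<bar>" if "q \<in> \<rat>" for q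
  proof -
    have "\<bar>F (q *\<^sub>R x)\<bar> \<le> 6 * Q * \<bar>q\<bar> * norm x + \<bar>q * F x\<bar>"
      using quasi_additive_rat[OF Q F that, of x] by linarith
    then show ?thesis by (simp add: K_def abs_mult algebra_simps)
  qed
  ultimately obtain a where "\<And>s t. a (s + t) = a s + a t"
      "\<And>t. \<bar>F (t *\<^sub>R x) - a t\<bar> \<le> 3 * K * \<bar>t\<bar>"
    using additive_approximation_real[OF K(1), of "\<lambda>t. F (t *\<^sub>R x)"] by blast
  then show ?thesis by blast
qed

section \<open>Regularization by a Hamel basis\<close>

text \<open>The functions \<open>a b\<close> are additive but perhaps not linear, so linear
  extension does not apply. They are evaluated at the coordinates instead, which depend additively
  on the vector.\<close>

lemma additive_extension_from_basis:
  fixes a :: "'a::real_vector \<Rightarrow> real \<Rightarrow> real"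
  assumes B: "independent B" "span B = UNIV"
    and a: "\<And>b s t. a b (s + t) = a b s + a b t"
  obtains L where "\<And>x y. L (x + y) = L x + L y" and "\<And>b t. b \<in> B \<Longrightarrow> L (t *\<^sub>R b) = a b t"
proof -
  have a0: "a b 0 = 0" for b using a[of b 0 0] by simp
  define S where "S x = {b. representation B x b \<noteq> 0}" for x
  have fin: "finite (S x)" for x unfolding S_def by (rule finite_representation)
  define L where "L x = (\<Sum>b\<in>S x. a b (representation B x b))" for x
  \<comment> \<open>Since \<open>a b 0 = 0\<close>, supports may be enlarged, so that sums for
    different vectors run over a common set.\<close>
  have L: "L x = (\<Sum>b\<in>T. a b (representation B x b))" if "finite T" "S x \<subseteq> T" for x T
    unfolding L_def using that by (intro sum.mono_neutral_left) (auto simp: S_def a0)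
  have "L (x + y) = L x + L y" for x y
  proof -
    let ?T = "S x \<union> S y"
    have rep: "representation B (x + y) b = representation B x b + representation B y b" for b
      using B by (simp add: representation_add)
    have "S (x + y) \<subseteq> ?T" by (auto simp: S_def rep)
    then have "L (x + y) = (\<Sum>b\<in>?T. a b (representation B (x + y) b))"
      using fin by (intro L) auto
    also have "\<dots> = (\<Sum>b\<in>?T. a b (representation B x b)) + (\<Sum>b\<in>?T. a b (representation B y b))"
      by (simp add: rep a sum.distrib)
    also have "\<dots> = L x + L y" using fin by (simp add: L[of ?T x] L[of ?T y])
    finally show ?thesis .
  qed
  moreover have "L (t *\<^sub>R b) = a b t" if "b \<in> B" for b t
  proof -
    have rep: "representation B (t *\<^sub>R b) c = (if c = b then t else 0)" for c
      using B that by (simp add: representation_scale representation_basis)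
    have "L (t *\<^sub>R b) = (\<Sum>c\<in>{b}. a c (representation B (t *\<^sub>R b) c))"
      by (intro L) (auto simp: S_def rep)
    then show ?thesis by (simp add: rep)
  qed
  ultimately show ?thesis by (rule that)
qed

lemma additive_regularization:
  fixes F :: "'a::real_normed_vector \<Rightarrow> real"
  assumes Q: "0 \<le> Q" and F: "dyadic_quasi_additive Q F"
  obtains L where "\<And>x y. L (x + y) = L x + L y"
    and "\<And>x t. \<bar>(F (t *\<^sub>R x) - L (t *\<^sub>R x)) - t * (F x - L x)\<bar> \<le> 7 * Q * \<bar>t\<bar> * norm x"
proof -
  define B :: "'a set" where "B = extend_basis {}"
  have B: "independent B" "span B = UNIV"
    unfolding B_def by (simp_all add: independent_extend_basis span_extend_basis independent_empty)
  obtain a where a: "\<And>b s t. a b (s + t) = a b s + a b t"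
      and Fa: "\<And>b. \<exists>C. \<forall>t. \<bar>F (t *\<^sub>R b) - a b t\<bar> \<le> C * \<bar>t\<bar>"
    using additive_approximation_line[OF Q F] by metis
  obtain L where L: "\<And>x y. L (x + y) = L x + L y" and LB: "\<And>b t. b \<in> B \<Longrightarrow> L (t *\<^sub>R b) = a b t"
    using additive_extension_from_basis[where a = a, OF B a] by blast
  define g where "g x = F x - L x" for x
  have g: "dyadic_quasi_additive Q g"
    using F L by (auto simp: dyadic_quasi_additive_def g_def scaleR_2 algebra_simps)
  \<comment> \<open>Linear growth holds on basis lines by the choice of \<open>L\<close>, and
    quasi-additivity carries it over to finite combinations.\<close>
  have "\<exists>C. \<forall>t. \<bar>g (t *\<^sub>R x)\<bar> \<le> C * \<bar>t\<bar>" if "x \<in> span B" for x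
    using that
  proof (induction rule: span_induct_alt)
    case base
    show ?case by (intro exI[of _ 0]) (simp add: quasi_additive_zero[OF Q g])
  next
    case (step c b x)
    obtain C where C: "\<And>t. \<bar>g (t *\<^sub>R b)\<bar> \<le> C * \<bar>t\<bar>"
      using Fa[of b] LB[OF step(1)] by (auto simp: g_def)
    obtain D where D: "\<And>t. \<bar>g (t *\<^sub>R x)\<bar> \<le> D * \<bar>t\<bar>" using step by blast
    have "\<bar>g (t *\<^sub>R (c *\<^sub>R b + x))\<bar> \<le> (C * \<bar>c\<bar> + D + Q * (\<bar>c\<bar> * norm b + norm x)) * \<bar>t\<bar>" for t
    proof -
      have "\<bar>g ((t * c) *\<^sub>R b + t *\<^sub>R x) - g ((t * c) *\<^sub>R b) - g (t *\<^sub>R x)\<bar>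
          \<le> Q * (norm ((t * c) *\<^sub>R b) + norm (t *\<^sub>R x))" by (rule quasi_additive_add[OF Q g])
      then have "\<bar>g (t *\<^sub>R (c *\<^sub>R b + x))\<bar>
          \<le> C * \<bar>t * c\<bar> + D * \<bar>t\<bar> + Q * (norm ((t * c) *\<^sub>R b) + norm (t *\<^sub>R x))"
        using C[of "t * c"] D[of t] unfolding scaleR_add_right scaleR_scaleR by linarith
      also have "\<dots> = (C * \<bar>c\<bar> + D + Q * (\<bar>c\<bar> * norm b + norm x)) * \<bar>t\<bar>"
        by (simp add: abs_mult algebra_simps)
      finally show ?thesis .
    qed
    then show ?case by blast
  qed
  then have "\<exists>C. \<forall>t. \<bar>g (t *\<^sub>R x)\<bar> \<le> C * \<bar>t\<bar>" for x using B by blast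
  then have "\<bar>g (t *\<^sub>R x) - t * g x\<bar> \<le> 7 * Q * \<bar>t\<bar> * norm x" for x t
    using quasi_additive_real[OF Q g] by metis
  then show ?thesis using L by (intro that[of L]) (auto simp: g_def)
qed

section \<open>Homogenization and the two implications\<close>

lemma homogenization:
  fixes g :: "'a::real_normed_vector \<Rightarrow> real"
  assumes add: "\<And>x y. \<bar>g (x + y) - g x - g y\<bar> \<le> Q * (norm x + norm y)"
    and hom: "\<And>t x. \<bar>g (t *\<^sub>R x) - t * g x\<bar> \<le> K * \<bar>t\<bar> * norm x"
    and K: "0 \<le> K"
  obtains h where "quasi_linear h" and "\<And>x. \<bar>h x - g x\<bar> \<le> K * norm x"
proof -
  \<comment> \<open>The odd part of \<open>g\<close> on the unit sphere, extended radially: oddness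
    gives exact homogeneity for negative scalars too.\<close>
  define h where "h x = norm x * (g (sgn x) - g (- sgn x)) / 2" for x
  have near: "\<bar>h x - g x\<bar> \<le> K * norm x" for x
  proof (cases "x = 0")
    case True
    then show ?thesis using hom[of 0 0] by (simp add: h_def)
  next
    case False
    have x: "norm x *\<^sub>R sgn x = x" using False by (simp add: sgn_div_norm)
    have "\<bar>g x - norm x * g (sgn x)\<bar> \<le> K * norm x"
      using hom[of "norm x" "sgn x"] False by (simp add: norm_sgn x)
    moreover have "\<bar>g x + norm x * g (- sgn x)\<bar> \<le> K * norm x"
      using hom[of "- norm x" "- sgn x"] False by (simp add: norm_sgn x)
    moreover have "2 * h x = norm x * g (sgn x) - norm x * g (- sgn x)"
      by (simp add: h_def right_diff_distrib)
    ultimately show ?thesis by linarith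
  qed
  have "h (t *\<^sub>R x) = t * h x" for t x
    by (cases t "0::real" rule: linorder_cases) (simp_all add: h_def sgn_scaleR algebra_simps)
  moreover have "\<bar>h (x + y) - h x - h y\<bar> \<le> (Q + 2 * K) * (norm x + norm y)" for x y
  proof -
    have "K * norm (x + y) \<le> K * (norm x + norm y)"
      using K by (intro mult_left_mono norm_triangle_ineq)
    with add[of x y] near[of x] near[of y] near[of "x + y"] show ?thesis
      by (simp add: abs_le_iff algebra_simps)
  qed
  ultimately have "quasi_linear h" unfolding quasi_linear_def by blast
  then show ?thesis using near by (rule that)
qed

lemma Jensen_approximation_if_K_space:
  fixes f :: "'a::banach \<Rightarrow> real"
  assumes X: "K_space TYPE('a)" and f: "eps_Jensen_on \<epsilon> (cball 0 1) f"
  obtains a where "Jensen_on (cball 0 1) a" and "bdd_above ((\<lambda>x. \<bar>f x - a x\<bar>) ` cball 0 1)"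
proof -
  have "\<bar>f ((0 + 0) /\<^sub>R 2) - (f 0 + f 0) / 2\<bar> \<le> \<epsilon>"
    using f unfolding eps_Jensen_on_def by (metis centre_in_cball zero_le_one)
  then have e0: "0 \<le> \<epsilon>" by simp
  have "f z - f 0 - (f x - f 0 + (f y - f 0)) / 2 = f z - (f x + f y) / 2" for x y z
    by (simp add: field_simps)
  then have "eps_Jensen_on \<epsilon> (cball 0 1) (\<lambda>x. f x - f 0)"
    using f by (simp only: eps_Jensen_on_def)
  then obtain F where F: "dyadic_quasi_additive (20 * \<epsilon>) F"
      and Ff: "\<And>x. norm x \<le> 1 \<Longrightarrow> \<bar>F x - (f x - f 0)\<bar> \<le> 2 * \<epsilon>"
    by (rule eps_Jensen_dyadic_extension) auto
  define Q where "Q = 20 * \<epsilon>"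
  have Q: "0 \<le> Q" "dyadic_quasi_additive Q F" using e0 F by (auto simp: Q_def)
  obtain L where L: "\<And>x y. L (x + y) = L x + L y"
      and FL: "\<And>x t. \<bar>(F (t *\<^sub>R x) - L (t *\<^sub>R x)) - t * (F x - L x)\<bar> \<le> 7 * Q * \<bar>t\<bar> * norm x"
    using additive_regularization[OF Q] by blast
  have "\<bar>(F (x + y) - L (x + y)) - (F x - L x) - (F y - L y)\<bar> \<le> Q * (norm x + norm y)" for x y
    using quasi_additive_add[OF Q, of x y] by (simp add: L algebra_simps)
  then obtain h where h: "quasi_linear h" and hF: "\<And>x. \<bar>h x - (F x - L x)\<bar> \<le> 7 * Q * norm x"
    using homogenization[of "\<lambda>x. F x - L x" Q "7 * Q"] FL Q by auto
  obtain l M where l: "linear l" and M: "\<And>x. \<bar>h x - l x\<bar> \<le> M * norm x"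
    using X h unfolding K_space_def by blast
  \<comment> \<open>The approximations run from \<open>f - f 0\<close> to \<open>F\<close>, from
    \<open>F - L\<close> to \<open>h\<close>, and from \<open>h\<close> to \<open>l\<close>. The
    possibly discontinuous \<open>L\<close> may stay, since additivity is enough for the Jensen
    equation.\<close>
  define a where "a x = L x + l x + f 0" for x
  have half: "L (x /\<^sub>R 2) = L x / 2" for x
    using L[of "x /\<^sub>R 2" "x /\<^sub>R 2"] by (simp add: scaleR_add_left[symmetric])
  have "Jensen_on (cball 0 1) a"
    unfolding Jensen_on_def a_def half
    by (simp add: L half linear_add[OF l] linear_cmul[OF l] field_simps)
  moreover have "bdd_above ((\<lambda>x. \<bar>f x - a x\<bar>) ` cball 0 1)"
  proof (rule bdd_aboveI2)
    fix x :: 'a assume "x \<in> cball 0 1"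
    then have x: "norm x \<le> 1" by simp
    have "7 * Q * norm x \<le> 7 * Q * 1" using Q x by (intro mult_left_mono) auto
    moreover have "M * norm x \<le> \<bar>M\<bar> * 1" using x by (intro mult_mono) auto
    ultimately show "\<bar>f x - a x\<bar> \<le> 2 * \<epsilon> + 7 * Q + \<bar>M\<bar>"
      using Ff[OF x] hF[of x] M[of x] unfolding a_def by linarith
  qed
  ultimately show ?thesis by (rule that)
qed

text \<open>With zero Jensen error the dyadic extension of \<open>a - a 0\<close> is exactly
  additive. Its distance to \<open>f\<close> commutes with doubling, so a bound on the ball becomes
  a multiple of the norm.\<close>

lemma linear_approximation_if_Jensen_approximation:
  fixes f :: "'a::real_normed_vector \<Rightarrow> real"
  assumes f: "quasi_linear f" and a: "Jensen_on (cball 0 1) a"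
    and C: "bdd_above ((\<lambda>x. \<bar>f x - a x\<bar>) ` cball 0 1)"
  obtains l M where "linear l" and "\<And>x. \<bar>f x - l x\<bar> \<le> M * norm x"
proof -
  obtain C where "\<forall>x\<in>cball 0 1. \<bar>f x - a x\<bar> \<le> C"
    using C by (auto simp: bdd_above_def)
  then have C: "\<bar>f x - a x\<bar> \<le> C" if "norm x \<le> 1" for x using that by simp
  have hom: "f (t *\<^sub>R x) = t * f x" for t x using f by (simp add: quasi_linear_def)
  have "a z - a 0 - (a x - a 0 + (a y - a 0)) / 2 = a z - (a x + a y) / 2" for x y z
    by (simp add: field_simps)
  then have "eps_Jensen_on 0 (cball 0 1) (\<lambda>x. a x - a 0)"
    using a by (simp only: Jensen_on_def eps_Jensen_on_def) simp
  then obtain A where "dyadic_quasi_additive (20 * 0) A"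
      and Aa: "\<And>x. norm x \<le> 1 \<Longrightarrow> \<bar>A x - (a x - a 0)\<bar> \<le> 2 * 0"
    by (rule eps_Jensen_dyadic_extension) auto
  then have A: "dyadic_quasi_additive 0 A" by simp
  have add: "A (x + y) = A x + A y" for x y using quasi_additive_add[OF _ A, of x y] by simp
  have near: "\<bar>f x - A x\<bar> \<le> 2 * (C + \<bar>a 0\<bar>) * norm x" for x
  proof (rule dyadic_bound)
    show "f (2 *\<^sub>R x) - A (2 *\<^sub>R x) = 2 * (f x - A x)" for x
      using quasi_additive_double[OF _ A] by (simp add: hom)
    show "\<bar>f x - A x\<bar> \<le> C + \<bar>a 0\<bar>" if "norm x \<le> 1" for x
      using C[OF that] Aa[OF that] by linarith
  qed
  have "A (t *\<^sub>R x) = t * A x" for t x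
  proof -
    \<comment> \<open>Closeness to the homogeneous \<open>f\<close> rules out wild additive
      behaviour on the line; as the quasi-additivity constant is 0,
      \<open>quasi_additive_real\<close> then gives an equality.\<close>
    have "\<bar>A (s *\<^sub>R x)\<bar> \<le> (\<bar>f x\<bar> + 2 * (C + \<bar>a 0\<bar>) * norm x) * \<bar>s\<bar>" for s
    proof -
      have "\<bar>A (s *\<^sub>R x)\<bar> \<le> \<bar>s * f x\<bar> + 2 * (C + \<bar>a 0\<bar>) * norm (s *\<^sub>R x)"
        using near[of "s *\<^sub>R x"] unfolding hom by linarith
      then show ?thesis by (simp add: abs_mult algebra_simps)
    qed
    from quasi_additive_real[OF _ A this, of t] show ?thesis by simp
  qed
  then have "linear A" using add by (intro linearI) auto
  then show ?thesis using near by (rule that)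
qed

lemma quasi_linear_imp_eps_Jensen:
  assumes "quasi_linear f"
  obtains \<epsilon> where "eps_Jensen_on \<epsilon> (cball 0 1) f"
proof -
  obtain Q where hom: "\<And>t x. f (t *\<^sub>R x) = t * f x"
      and Q: "\<And>x y. \<bar>f (x + y) - f x - f y\<bar> \<le> Q * (norm x + norm y)"
    using assms unfolding quasi_linear_def by blast
  have "\<bar>f ((x + y) /\<^sub>R 2) - (f x + f y) / 2\<bar> \<le> \<bar>Q\<bar>" if "x \<in> cball 0 1" "y \<in> cball 0 1" for x y
  proof -
    \<comment> \<open>By homogeneity the Jensen defect is half the quasi-linearity defect, which
      cancels this 2.\<close>
    have "Q * (norm x + norm y) \<le> \<bar>Q\<bar> * 2" using that by (intro mult_mono) auto
    then show ?thesis using Q[of x y] unfolding hom by (simp add: field_simps abs_le_iff)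
  qed
  then show ?thesis by (intro that[of "\<bar>Q\<bar>"]) (auto simp: eps_Jensen_on_def)
qed

theorem theorem2:
  shows "K_space TYPE('a::banach) \<longleftrightarrow>
    (\<forall>(\<epsilon>::real) (f :: 'a \<Rightarrow> real). eps_Jensen_on \<epsilon> (cball 0 1) f \<longrightarrow>
       (\<exists>a :: 'a \<Rightarrow> real. Jensen_on (cball 0 1) a \<and>
          bdd_above ((\<lambda>x. \<bar>f x - a x\<bar>) ` cball 0 1)))"
    (is "?K \<longleftrightarrow> ?J")
proof
  assume ?K
  then show ?J using Jensen_approximation_if_K_space by metis
next
  assume J: ?J
  show ?K unfolding K_space_def
  proof (intro allI impI)
    fix f :: "'a \<Rightarrow> real" assume f: "quasi_linear f"
    obtain \<epsilon> where "eps_Jensen_on \<epsilon> (cball 0 1) f" using quasi_linear_imp_eps_Jensen[OF f] .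
    from J[rule_format, OF this] obtain a where a: "Jensen_on (cball 0 1) a"
      "bdd_above ((\<lambda>x. \<bar>f x - a x\<bar>) ` cball 0 1)"
      by blast
    obtain l M where "linear l" "\<And>x. \<bar>f x - l x\<bar> \<le> M * norm x"
      using linear_approximation_if_Jensen_approximation[OF f a] by blast
    then show "\<exists>l. linear l \<and> (\<exists>M. \<forall>x. \<bar>f x - l x\<bar> \<le> M * norm x)" by blast
  qed
qed

end
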